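(* Let $X$ be a real Banach space, $C\subset X$ a nonempty closed bounded convex set, $f:X\to\mathbb{R}$ a convex, continuously Fréchet differentiable function, and $g:X\to(-\infty,\infty]$ a proper, lower semicontinuous, convex function with $C\subset\{x\in X:g(x)<\infty\}$. Put $\varphi=f+g$ and assume that $\varphi$ attains its minimum over $C$. Assume the Fréchet derivative $f'$ of $f$ is uniformly continuous on $C$. Let $\{x_k\}_{k\ge0}$ be a sequence generated by the generalized Frank-Wolfe algorithm from an arbitrary $x_0\in C$, where the subproblem $\min_{x\in C}\{\langle f'(x_k),x\rangle+g(x)\}$ is assumed solvable for each $k$ and each stepsize is selected by line minimization search, i.e. $\gamma_k\in[0,1]$ is a minimizer of $\gamma\mapsto f(x_k+\gamma(\bar x_k-x_k))+g(x_k+\gamma(\bar x_k-x_k))$ over $[0,1]$. Then (i) $\varphi(x_{k+1})\le\varphi(x_k)$ for all $k\ge0$; and (ii) $\lim_{k\to\infty}\varphi(x_k)=\varphi^*:=\min_{x\in C}\varphi(x)$.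
   Context: $\langle\cdot,\cdot\rangle$ is the pairing between the dual $X^*$ and $X$. Generalized Frank-Wolfe algorithm for $\min_{x\in C}\varphi(x)=f(x)+g(x)$: given $x_0\in C$, for each $k\ge0$ choose $\bar x_k\in C$ to be a minimizer of $x\mapsto\langle f'(x_k),x\rangle+g(x)$ over $C$, and set $x_{k+1}=x_k+\gamma_k(\bar x_k-x_k)$, where $\gamma_k$ is the stepsize. *)

theory Defs
  imports "HOL-Analysis.Analysis"
begin

definition proper_ereal_fun :: "('a \<Rightarrow> ereal) \<Rightarrow> bool" where
  "proper_ereal_fun g \<longleftrightarrow> (\<forall>x. g x \<noteq> -\<infinity>) \<and> (\<exists>x. g x < \<infinity>)"

text \<open>Only used for functions that never take the value \<open>-\<infinity>\<close>, so the sum on the right is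
  never of the form \<open>\<infinity> - \<infinity>\<close>; at \<open>t = 0\<close> and \<open>t = 1\<close> the convention \<open>0 * \<infinity> = 0\<close> applies.\<close>

definition convex_ereal_fun :: "('a::real_vector \<Rightarrow> ereal) \<Rightarrow> bool" where
  "convex_ereal_fun g \<longleftrightarrow>
     (\<forall>x y. \<forall>t\<in>{0..1::real}.
        g ((1 - t) *\<^sub>R x + t *\<^sub>R y) \<le> ereal (1 - t) * g x + ereal t * g y)"

definition lsc_ereal_fun :: "('a::topological_space \<Rightarrow> ereal) \<Rightarrow> bool" where
  "lsc_ereal_fun g \<longleftrightarrow> (\<forall>x. g x \<le> Liminf (at x) g)"

definition composite_objective :: "('a \<Rightarrow> real) \<Rightarrow> ('a \<Rightarrow> ereal) \<Rightarrow> 'a \<Rightarrow> ereal" where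
  "composite_objective f g x = ereal (f x) + g x"

text \<open>In the next two definitions \<open>f'\<close> is the gradient map into the dual space (with its operator
  norm), \<open>xb k\<close> is the subproblem solution chosen at step \<open>k\<close>, and \<open>\<gamma> k\<close> is the stepsize.\<close>

definition generalized_frank_wolfe ::
  "'a::real_normed_vector set \<Rightarrow> ('a \<Rightarrow> ('a \<Rightarrow>\<^sub>L real)) \<Rightarrow> ('a \<Rightarrow> ereal)
     \<Rightarrow> (nat \<Rightarrow> 'a) \<Rightarrow> (nat \<Rightarrow> 'a) \<Rightarrow> (nat \<Rightarrow> real) \<Rightarrow> bool" where
  "generalized_frank_wolfe C f' g x xb \<gamma> \<longleftrightarrow>
     x 0 \<in> C \<and>
     (\<forall>k. is_arg_min (\<lambda>u. ereal (blinfun_apply (f' (x k)) u) + g u) (\<lambda>u. u \<in> C) (xb k) \<and>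
          x (Suc k) = x k + \<gamma> k *\<^sub>R (xb k - x k))"

definition line_minimization_steps ::
  "('a::real_vector \<Rightarrow> real) \<Rightarrow> ('a \<Rightarrow> ereal)
     \<Rightarrow> (nat \<Rightarrow> 'a) \<Rightarrow> (nat \<Rightarrow> 'a) \<Rightarrow> (nat \<Rightarrow> real) \<Rightarrow> bool" where
  "line_minimization_steps f g x xb \<gamma> \<longleftrightarrow>
     (\<forall>k. is_arg_min (\<lambda>s. ereal (f (x k + s *\<^sub>R (xb k - x k))) + g (x k + s *\<^sub>R (xb k - x k)))
            (\<lambda>s. s \<in> {0..1}) (\<gamma> k))"

end

theory Submission
  imports Defs
begin

text \<open>
  Write \<open>h\<^sub>k = \<phi> (x\<^sub>k) - \<phi>\<^sup>*\<close>. The gradient inequality at the new point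
  \<open>y = x\<^sub>k + s (xb\<^sub>k - x\<^sub>k)\<close>, convexity of \<open>g\<close> and optimality of \<open>xb\<^sub>k\<close> in the subproblem give
  \<open>h\<^sub>k\<^sub>+\<^sub>1 \<le> (1 - s) h\<^sub>k + s \<parallel>f' y - f' x\<^sub>k\<parallel> diam C\<close> for every \<open>s\<close> in \<open>[0, 1]\<close>. By uniform continuity of
  \<open>f'\<close> on the bounded set \<open>C\<close>, for each \<open>e > 0\<close> there is one \<open>s > 0\<close>, independent of \<open>k\<close>, with
  \<open>h\<^sub>k\<^sub>+\<^sub>1 \<le> (1 - s) h\<^sub>k + s e\<close>. So the limit of the nonincreasing sequence \<open>h\<close> is at most \<open>e\<close>.
\<close>

text \<open>Restricting \<open>f\<close> to the line through \<open>y\<close> and \<open>z\<close>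
  gives a convex function \<open>p\<close> of one real variable. By the chain rule its slope at 0 is
  \<open>D (z - y)\<close>, so the claim is that the graph of \<open>p\<close> lies above its
  tangent at 0, read off at 1.\<close>

lemma convex_on_gradient_inequality:
  fixes f :: "'a::real_normed_vector \<Rightarrow> real"
  assumes "convex_on UNIV f" and "(f has_derivative D) (at y)"
  shows "f y + D (z - y) \<le> f z"
proof -
  define p where "p = (\<lambda>t. f (y + t *\<^sub>R (z - y)))"
  have "convex_on UNIV p"
  proof (rule convex_onI)
    fix t a b :: real
    assume t: "0 < t" "t < 1"
    have "y + ((1 - t) *\<^sub>R a + t *\<^sub>R b) *\<^sub>R (z - y)
        = (1 - t) *\<^sub>R (y + a *\<^sub>R (z - y)) + t *\<^sub>R (y + b *\<^sub>R (z - y))"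
      by (simp add: algebra_simps)
    then show "p ((1 - t) *\<^sub>R a + t *\<^sub>R b) \<le> (1 - t) * p a + t * p b"
      unfolding p_def using convex_onD[OF assms(1), of t] t by simp
  qed simp
  moreover have "(p has_real_derivative D (z - y)) (at 0)"
  proof -
    have "((\<lambda>t. y + t *\<^sub>R (z - y)) has_vector_derivative (z - y)) (at 0)"
      by (auto intro!: derivative_eq_intros)
    moreover have "(f has_derivative D) (at (y + 0 *\<^sub>R (z - y)))"
      using assms(2) by simp
    ultimately have "(f \<circ> (\<lambda>t. y + t *\<^sub>R (z - y)) has_vector_derivative D (z - y)) (at 0)"
      by (intro vector_derivative_diff_chain_within) (auto intro: has_derivative_at_withinI)
    then show ?thesis
      by (simp add: p_def comp_def has_real_derivative_iff_has_vector_derivative)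
  qed
  ultimately have "p 1 - p 0 \<ge> D (z - y) * (1 - 0)"
    by (intro convex_on_imp_above_tangent) auto
  then show ?thesis
    by (simp add: p_def)
qed

text \<open>One step towards the subproblem solution \<open>b\<close>, compared with an arbitrary
  competitor \<open>u\<close> in \<open>C\<close>. The factor \<open>1 - s\<close> is the ideal
  contraction; the last term is the price of replacing \<open>f' y\<close> by \<open>f' a\<close>,
  and it is small when \<open>y\<close> is close to \<open>a\<close>.\<close>

lemma frank_wolfe_descent:
  fixes f G :: "'a::real_normed_vector \<Rightarrow> real" and f' :: "'a \<Rightarrow> ('a \<Rightarrow>\<^sub>L real)"
  assumes f: "convex_on UNIV f" and f': "\<And>u. (f has_derivative blinfun_apply (f' u)) (at u)"
    and G: "convex_on C G" and in_C: "a \<in> C" "b \<in> C" "u \<in> C"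
    and b: "f' a b + G b \<le> f' a u + G u"
    and s: "0 \<le> s" "s \<le> 1" and y: "y = a + s *\<^sub>R (b - a)"
  shows "f y + G y - (f u + G u)
    \<le> (1 - s) * (f a + G a - (f u + G u)) + s * (norm (f' y - f' a) * norm (b - a))"
proof -
  \<comment> \<open>The tangent at the new point \<open>y\<close>, evaluated at the old point
    \<open>a\<close>, bounds \<open>f y\<close> from above.\<close>
  have "a - y = (- s) *\<^sub>R (b - a)"
    using y by simp
  then have "f' y (a - y) = - (s * f' y (b - a))"
    by (simp only: blinfun.scaleR_right) simp
  then have "f y \<le> f a + s * f' y (b - a)"
    using convex_on_gradient_inequality[OF f f', of y a] by simp
  moreover have "f' y (b - a) \<le> f' a (b - a) + norm (f' y - f' a) * norm (b - a)"
    using norm_blinfun[of "f' y - f' a" "b - a"] by (simp add: blinfun.diff_left)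
  then have "s * f' y (b - a) \<le> s * (f' a (b - a) + norm (f' y - f' a) * norm (b - a))"
    using s(1) by (rule mult_left_mono)
  moreover have "y = (1 - s) *\<^sub>R a + s *\<^sub>R b"
    using y by (simp add: algebra_simps)
  then have "G y \<le> (1 - s) * G a + s * G b"
    using convex_onD[OF G s in_C(1,2)] by simp
  \<comment> \<open>Optimality of \<open>b\<close> allows \<open>b\<close> to be exchanged for
    \<open>u\<close>; the tangent at \<open>a\<close> then turns the linear term into
    \<open>f u - f a\<close>.\<close>
  moreover have "f' a (b - a) + G b - G a \<le> (f u + G u) - (f a + G a)"
    using convex_on_gradient_inequality[OF f f', of a u] b by (simp add: blinfun.diff_right)
  then have "s * (f' a (b - a) + G b - G a) \<le> s * ((f u + G u) - (f a + G a))"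
    using s by (intro mult_left_mono)
  ultimately show ?thesis
    by (simp add: algebra_simps)
qed

text \<open>The limit \<open>L\<close> exists by monotonicity and boundedness below. Since
  \<open>s\<close> depends on \<open>e\<close> but not on \<open>k\<close>, the recursion passes to
  the limit and yields \<open>s * L \<le> s * e\<close>, where \<open>s\<close> cancels.\<close>

lemma decseq_tendsto_0_if_contracting:
  fixes h :: "nat \<Rightarrow> real"
  assumes "decseq h" and nonneg: "\<And>k. 0 \<le> h k"
    and contr: "\<And>e. e > 0 \<Longrightarrow> \<exists>s>0. \<forall>k. h (Suc k) \<le> (1 - s) * h k + s * e"
  shows "h \<longlonglongrightarrow> 0"
proof -
  obtain L where L: "h \<longlonglongrightarrow> L"
    using decseq_convergent[OF \<open>decseq h\<close>] nonneg by metis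
  have "L \<le> 0 + e" if "e > 0" for e
  proof -
    obtain s where s: "s > 0" "\<And>k. h (Suc k) \<le> (1 - s) * h k + s * e"
      using contr[OF \<open>e > 0\<close>] by blast
    have "(\<lambda>k. h (Suc k)) \<longlonglongrightarrow> L" "(\<lambda>k. (1 - s) * h k + s * e) \<longlonglongrightarrow> (1 - s) * L + s * e"
      using L by (auto intro!: tendsto_intros LIMSEQ_Suc)
    then have "L \<le> (1 - s) * L + s * e"
      by (rule LIMSEQ_le) (use s(2) in auto)
    then have "s * L \<le> s * e"
      by (simp add: algebra_simps)
    then show ?thesis
      using s(1) by simp
  qed
  then have "L \<le> 0"
    by (rule field_le_epsilon)
  moreover have "0 \<le> L"
    using L nonneg by (intro LIMSEQ_le_const) auto
  ultimately show ?thesis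
    using L by simp
qed

text \<open>Finiteness of \<open>g\<close> on \<open>C\<close> lets the whole descent argument run
  in the reals.\<close>

lemma convex_on_real_of_ereal:
  assumes "convex_ereal_fun g" and "convex C" and "\<And>u. u \<in> C \<Longrightarrow> \<bar>g u\<bar> \<noteq> \<infinity>"
  shows "convex_on C (\<lambda>u. real_of_ereal (g u))"
proof (rule convex_onI)
  fix t :: real and a b
  assume t: "0 < t" "t < 1" and ab: "a \<in> C" "b \<in> C"
  define c where "c = (1 - t) *\<^sub>R a + t *\<^sub>R b"
  have "c \<in> C"
    unfolding c_def using \<open>convex C\<close> ab t by (intro convexD) auto
  then obtain p q r where "g a = ereal p" "g b = ereal q" "g c = ereal r"
    using assms(3) ab by (metis ereal_real')
  moreover have "g c \<le> ereal (1 - t) * g a + ereal t * g b"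
    using assms(1) t unfolding convex_ereal_fun_def c_def by simp
  ultimately show "real_of_ereal (g ((1 - t) *\<^sub>R a + t *\<^sub>R b))
      \<le> (1 - t) * real_of_ereal (g a) + t * real_of_ereal (g b)"
    by (simp flip: c_def)
qed fact

theorem theorem5p1:
  fixes C :: "'a::banach set"
    and f :: "'a \<Rightarrow> real"
    and f' :: "'a \<Rightarrow> ('a \<Rightarrow>\<^sub>L real)"
    and g :: "'a \<Rightarrow> ereal"
    and x xb :: "nat \<Rightarrow> 'a"
    and \<gamma> :: "nat \<Rightarrow> real"
  assumes "C \<noteq> {}" and "closed C" and "bounded C" and "convex C"
    and "convex_on UNIV f"
    and "\<And>u. (f has_derivative blinfun_apply (f' u)) (at u)"
    and "continuous_on UNIV f'"
    and "proper_ereal_fun g" and "lsc_ereal_fun g" and "convex_ereal_fun g"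
    and "C \<subseteq> {u. g u < \<infinity>}"
    and "\<exists>u. is_arg_min (composite_objective f g) (\<lambda>u. u \<in> C) u"
    and "uniformly_continuous_on C f'"
    and "generalized_frank_wolfe C f' g x xb \<gamma>"
    and "line_minimization_steps f g x xb \<gamma>"
  shows "(\<forall>k. composite_objective f g (x (Suc k)) \<le> composite_objective f g (x k)) \<and>
         (\<lambda>k. composite_objective f g (x k)) \<longlonglongrightarrow> (INF u\<in>C. composite_objective f g u)"
proof -
  define G where "G = (\<lambda>u. real_of_ereal (g u))"
  \<comment> \<open>Properness excludes the value minus infinity, and \<open>C\<close> lying in the
    domain of \<open>g\<close> excludes plus infinity.\<close>
  have fin: "\<bar>g u\<bar> \<noteq> \<infinity>" if "u \<in> C" for u
    using assms(8,11) that unfolding proper_ereal_fun_def by fastforce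
  have gG: "g u = ereal (G u)" if "u \<in> C" for u
    using fin[OF that] by (simp add: G_def ereal_real')
  have convex_G: "convex_on C G"
    unfolding G_def using assms(10,4) fin by (rule convex_on_real_of_ereal)
  define \<phi> where "\<phi> = (\<lambda>u. f u + G u)"
  have obj: "composite_objective f g u = ereal (\<phi> u)" if "u \<in> C" for u
    using gG[OF that] by (simp add: composite_objective_def \<phi>_def)

  have xb: "xb k \<in> C" and x_Suc: "x (Suc k) = x k + \<gamma> k *\<^sub>R (xb k - x k)"
    and \<gamma>: "\<gamma> k \<in> {0..1}" for k
    using assms(14,15)
    by (auto simp: generalized_frank_wolfe_def line_minimization_steps_def is_arg_min_def)
  have segment: "a + s *\<^sub>R (b - a) \<in> C" if "a \<in> C" "b \<in> C" "s \<in> {0..1}" for a b s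
  proof -
    have "(1 - s) *\<^sub>R a + s *\<^sub>R b \<in> C"
      using assms(4) that by (intro convexD) auto
    then show ?thesis
      by (simp add: algebra_simps)
  qed
  have x: "x k \<in> C" for k
  proof (induction k)
    case 0
    then show ?case
      using assms(14) by (simp add: generalized_frank_wolfe_def)
  next
    case (Suc k)
    then show ?case
      using segment xb \<gamma> x_Suc by simp
  qed
  have sub: "f' (x k) (xb k) + G (xb k) \<le> f' (x k) u + G u" if "u \<in> C" for k u
  proof -
    have "ereal (f' (x k) (xb k)) + g (xb k) \<le> ereal (f' (x k) u) + g u"
      using assms(14) that by (simp add: generalized_frank_wolfe_def is_arg_min_linorder)
    then show ?thesis
      by (simp add: gG xb that)
  qed
  have line: "\<phi> (x (Suc k)) \<le> \<phi> (x k + s *\<^sub>R (xb k - x k))" if "s \<in> {0..1}" for k s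
  proof -
    have "composite_objective f g (x (Suc k))
        \<le> composite_objective f g (x k + s *\<^sub>R (xb k - x k))"
      using assms(15) that
      by (simp add: line_minimization_steps_def is_arg_min_linorder composite_objective_def x_Suc)
    then show ?thesis
      by (simp add: obj x segment xb that del: atLeastAtMost_iff)
  qed
  \<comment> \<open>The zero stepsize is admissible in the line search.\<close>
  have mono: "\<phi> (x (Suc k)) \<le> \<phi> (x k)" for k
    using line[of 0 k] by simp

  obtain m where m: "m \<in> C"
    and min: "\<And>u. u \<in> C \<Longrightarrow> composite_objective f g m \<le> composite_objective f g u"
    using assms(12) by (auto simp: is_arg_min_linorder)
  have INF: "(INF u\<in>C. composite_objective f g u) = ereal (\<phi> m)"
    using m min obj[OF m] by (metis (no_types, lifting) INF_greatest INF_lower antisym)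
  define h where "h = (\<lambda>k. \<phi> (x k) - \<phi> m)"
  have "h \<longlonglongrightarrow> 0"
  proof (rule decseq_tendsto_0_if_contracting)
    show "decseq h"
      using mono by (intro decseq_SucI) (simp add: h_def)
    show "0 \<le> h k" for k
      using min[OF x, of k] by (simp add: h_def obj x m)
    fix e :: real
    assume "e > 0"
    obtain B where B: "B > 0" "\<And>u. u \<in> C \<Longrightarrow> norm u \<le> B"
      using assms(3) bounded_pos by blast
    have diam: "norm (xb k - x k) \<le> 2 * B" for k
      using norm_triangle_ineq4[of "xb k" "x k"] B(2)[OF xb, of k] B(2)[OF x, of k] by simp
    \<comment> \<open>The tolerance is divided by \<open>2 * B\<close> to absorb the bound
      \<open>diam\<close> on the search direction.\<close>
    obtain d where d: "d > 0"
      "\<And>u v. u \<in> C \<Longrightarrow> v \<in> C \<Longrightarrow> dist v u < d \<Longrightarrow> dist (f' v) (f' u) < e / (2 * B)"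
      using assms(13) \<open>e > 0\<close> B(1) unfolding uniformly_continuous_on_def
      by (metis divide_pos_pos mult_pos_pos zero_less_numeral)
    \<comment> \<open>By \<open>diam\<close>, a step of size \<open>s\<close> moves the iterate by
      at most \<open>d / 2\<close>, uniformly in \<open>k\<close>; the cap 1 keeps the new point on
      the segment.\<close>
    define s where "s = min 1 (d / (4 * B))"
    have s: "0 < s" "s \<le> 1" "s * (2 * B) < d"
      using d(1) B(1) by (auto simp: s_def min_def field_simps)
    have "h (Suc k) \<le> (1 - s) * h k + s * e" for k
    proof -
      define y where "y = x k + s *\<^sub>R (xb k - x k)"
      have "y \<in> C"
        unfolding y_def using segment x xb s by simp
      have "dist y (x k) = s * norm (xb k - x k)"
        using s by (simp add: y_def dist_norm)
      also have "\<dots> \<le> s * (2 * B)"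
        using s diam by (intro mult_left_mono) auto
      finally have "norm (f' y - f' (x k)) \<le> e / (2 * B)"
        using d(2)[OF x \<open>y \<in> C\<close>] s(3) by (simp add: dist_norm less_imp_le)
      then have "norm (f' y - f' (x k)) * norm (xb k - x k) \<le> e / (2 * B) * (2 * B)"
        using diam B(1) \<open>e > 0\<close> by (intro mult_mono) auto
      also have "\<dots> = e"
        using B(1) by simp
      finally have "s * (norm (f' y - f' (x k)) * norm (xb k - x k)) \<le> s * e"
        using s by (intro mult_left_mono) auto
      moreover have "\<phi> y - \<phi> m
          \<le> (1 - s) * (\<phi> (x k) - \<phi> m) + s * (norm (f' y - f' (x k)) * norm (xb k - x k))"
        unfolding \<phi>_def
        using frank_wolfe_descent[OF assms(5,6) convex_G x xb m sub[OF m] _ s(2) y_def] s(1)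
        by simp
      \<comment> \<open>The actual stepsize \<open>\<gamma> k\<close> may differ from
        \<open>s\<close>, but the line search does at least as well.\<close>
      moreover have "h (Suc k) \<le> \<phi> y - \<phi> m"
        using line[of s k] s by (simp add: h_def y_def)
      ultimately show ?thesis
        unfolding h_def by linarith
    qed
    then show "\<exists>s>0. \<forall>k. h (Suc k) \<le> (1 - s) * h k + s * e"
      using s(1) by blast
  qed
  then have "(\<lambda>k. \<phi> (x k)) \<longlonglongrightarrow> \<phi> m"
    by (simp add: h_def LIM_zero_iff)
  then show ?thesis
    unfolding INF using mono by (simp add: obj x)
qed

end
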